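(* Let $\mathcal{P}$ be a finite patchwork on a set $\Omega$. The following are equivalent: (a) $\Omega$ admits a total ordering $\leq$ under which all $\mathcal{P}$-sets are convex; (b) no three nonempty $\mathcal{P}$-sets are pairwise adjacent; (c) every autonomous set $B\subseteq\Omega$ satisfies one of the following: either (ii) the cohort under $B$ has at least $2$ members, its adjacency graph is a path (elements $A_1,\dots,A_n$, $n\geq 2$, with $A_i,A_j$ adjacent iff $|i-j|=1$), and the union of the cohort is $B$; or (iii) no two members of the cohort under $B$ are adjacent.
   Context: A subset $A$ of a totally ordered set $(\Omega,\leq)$ is convex if $p\leq q\leq r$ with $p,r\in A$ implies $q\in A$. Subsets $A,B\subseteq\Omega$ overlap if $A\cap B\neq\emptyset$ but neither contains the other. A patchwork on $\Omega$ is a set $\mathcal{P}$ of subsets of $\Omega$ such that $\emptyset,\Omega\in\mathcal{P}$ and for every pair of overlapping $A,B\in\mathcal{P}$, the sets $A\cap B$, $A\cup B$, $A\setminus B$ belong to $\mathcal{P}$. Members of $\mathcal{P}$ are called $\mathcal{P}$-sets. A $\mathcal{P}$-set is autonomous if it is nonempty and does not overlap any member of $\mathcal{P}$. If $B$ is autonomous, the cohort under $B$ is the set of maximal autonomous proper subsets of $B$. Two $\mathcal{P}$-sets are adjacent if they are disjoint and their union is a $\mathcal{P}$-set. The adjacency graph of a family of $\mathcal{P}$-sets has the members as vertices, with an edge between two iff they are adjacent. *)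

theory Defs
  imports Main
begin

definition convex_wrt :: "'a rel \<Rightarrow> 'a set \<Rightarrow> 'a set \<Rightarrow> bool" where
  "convex_wrt r \<Omega> A \<longleftrightarrow>
     (\<forall>p\<in>A. \<forall>s\<in>A. \<forall>q\<in>\<Omega>. (p, q) \<in> r \<and> (q, s) \<in> r \<longrightarrow> q \<in> A)"

definition overlap :: "'a set \<Rightarrow> 'a set \<Rightarrow> bool" where
  "overlap A B \<longleftrightarrow> A \<inter> B \<noteq> {} \<and> \<not> A \<subseteq> B \<and> \<not> B \<subseteq> A"

definition patchwork :: "'a set \<Rightarrow> 'a set set \<Rightarrow> bool" where
  "patchwork \<Omega> P \<longleftrightarrow>
     P \<subseteq> Pow \<Omega> \<and> {} \<in> P \<and> \<Omega> \<in> P \<and>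
     (\<forall>A\<in>P. \<forall>B\<in>P. overlap A B \<longrightarrow> A \<inter> B \<in> P \<and> A \<union> B \<in> P \<and> A - B \<in> P)"

definition autonomous :: "'a set set \<Rightarrow> 'a set \<Rightarrow> bool" where
  "autonomous P A \<longleftrightarrow> A \<in> P \<and> A \<noteq> {} \<and> (\<forall>B\<in>P. \<not> overlap A B)"

definition cohort :: "'a set set \<Rightarrow> 'a set \<Rightarrow> 'a set set" where
  "cohort P B =
     {A. autonomous P A \<and> A \<subset> B \<and> \<not> (\<exists>C. autonomous P C \<and> A \<subset> C \<and> C \<subset> B)}"

definition adjacent :: "'a set set \<Rightarrow> 'a set \<Rightarrow> 'a set \<Rightarrow> bool" where
  "adjacent P A B \<longleftrightarrow> A \<in> P \<and> B \<in> P \<and> A \<inter> B = {} \<and> A \<union> B \<in> P"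

text \<open>
  A simple graph is a pair of a vertex set and a set of edges, each edge being a
  two-element set of vertices.
\<close>

definition adjacency_graph :: "'a set set \<Rightarrow> 'a set set \<Rightarrow> 'a set set \<times> 'a set set set" where
  "adjacency_graph P F =
     (F, {{A, B} |A B. A \<in> F \<and> B \<in> F \<and> A \<noteq> B \<and> adjacent P A B})"

definition is_path_graph :: "'v set \<times> 'v set set \<Rightarrow> bool" where
  "is_path_graph G \<longleftrightarrow>
     (\<exists>(n::nat) v. n \<ge> 1 \<and> bij_betw v {1..n} (fst G) \<and>
        (\<forall>i\<in>{1..n}. \<forall>j\<in>{1..n}. {v i, v j} \<in> snd G \<longleftrightarrow> \<bar>int i - int j\<bar> = 1))"

end

theory Submission
  imports Defs
begin

text \<open>
  The \<open>P\<close>-sets properly inside an autonomous set \<open>B\<close> and not inside a member of its cohort are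
  unions of cohort members. If two cohort members are adjacent and no three nonempty \<open>P\<close>-sets
  are pairwise adjacent, a connected component of the adjacency graph of the cohort has no vertex
  of degree three and no cycle, so it is a path; its union is autonomous, hence equal to \<open>B\<close>.
  Conversely, total orders on the cohort members are concatenated along the path (or in any order
  if there are no adjacencies, since then no \<open>P\<close>-set properly between a cohort member and \<open>B\<close>
  exists); a union of path members in \<open>P\<close> is an interval, since cutting it down to the ends of a
  gap would make two non-consecutive members adjacent.
\<close>

section \<open>Linear orders and their concatenation\<close>

lemma linear_order_on_exists: "\<exists>r. linear_order_on A r"
  using well_order_on[of A] unfolding well_order_on_def by blast

text \<open>Lexicographic comparison: the fibres of \<open>f\<close> are stacked by index, and each
  \<open>R i\<close> decides inside its own fibre. Indices with an empty fibre are allowed.\<close>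

lemma linear_order_on_concatenation:
  fixes f :: "'a \<Rightarrow> nat"
  assumes "\<And>i. linear_order_on {x \<in> B. f x = i} (R i)"
  shows "linear_order_on B
    {(x, y). x \<in> B \<and> y \<in> B \<and> (f x < f y \<or> f x = f y \<and> (x, y) \<in> R (f x))}"
    (is "linear_order_on B ?r")
proof -
  have re: "(x, x) \<in> R (f x)" if "x \<in> B" for x
    using assms[of "f x"] that
    unfolding linear_order_on_def partial_order_on_def preorder_on_def refl_on_def by auto
  have tr: "(x, z) \<in> R i" if "(x, y) \<in> R i" "(y, z) \<in> R i" for x y z i
    using assms[of i] that
    unfolding linear_order_on_def partial_order_on_def preorder_on_def trans_def by blast
  have an: "x = y" if "(x, y) \<in> R i" "(y, x) \<in> R i" for x y i
    using assms[of i] that unfolding linear_order_on_def partial_order_on_def antisym_def by blast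
  have to: "(x, y) \<in> R (f x) \<or> (y, x) \<in> R (f x)" if "x \<in> B" "y \<in> B" "f x = f y" for x y
    using assms[of "f x"] re that unfolding linear_order_on_def total_on_def by (cases "x = y") auto
  have "refl_on B ?r" using re by (auto simp: refl_on_def)
  moreover have "?r \<subseteq> B \<times> B" by auto
  moreover have "trans ?r"
  proof (rule transI)
    fix x y z assume "(x, y) \<in> ?r" "(y, z) \<in> ?r"
    then show "(x, z) \<in> ?r" using tr[of x y "f x" z] by auto
  qed
  moreover have "antisym ?r" using an by (auto simp: antisym_def)
  moreover have "total_on B ?r" using to by (auto simp: total_on_def) (metis nat_neq_iff)+
  ultimately show ?thesis
    unfolding linear_order_on_def partial_order_on_def preorder_on_def by blast
qed

section \<open>Convexity against three pairwise adjacent sets\<close>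

lemma convex_triple_not_pairwise_adjacent:
  assumes lin: "linear_order_on \<Omega> r" and conv: "\<And>A. A \<in> P \<Longrightarrow> convex_wrt r \<Omega> A" and "P \<subseteq> Pow \<Omega>"
    and ne: "A \<noteq> {}" "B \<noteq> {}" "C \<noteq> {}"
    and adj: "adjacent P A B" "adjacent P B C" "adjacent P A C"
  shows False
proof -
  \<comment> \<open>\<open>X \<union> Z\<close> is a \<open>P\<close>-set, hence convex, so it would
    contain the point \<open>y\<close> between \<open>x\<close> and \<open>z\<close>, although
    \<open>Y\<close> is disjoint from both.\<close>
  have mid: False if "x \<in> X" "y \<in> Y" "z \<in> Z" "adjacent P X Z" "X \<inter> Y = {}" "Y \<inter> Z = {}" "y \<in> \<Omega>"
    "(x, y) \<in> r" "(y, z) \<in> r" for x y z X Y Z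
    using conv[of "X \<union> Z"] that unfolding adjacent_def convex_wrt_def by blast
  obtain a b c where abc: "a \<in> A" "b \<in> B" "c \<in> C" using ne by blast
  have om: "a \<in> \<Omega>" "b \<in> \<Omega>" "c \<in> \<Omega>" using abc adj assms(3) unfolding adjacent_def by auto
  have disj: "A \<inter> B = {}" "B \<inter> C = {}" "A \<inter> C = {}" using adj unfolding adjacent_def by auto
  have adj': "adjacent P B A" "adjacent P C B" "adjacent P C A"
    using adj unfolding adjacent_def by (auto simp: Un_commute)
  have "a \<noteq> b" "b \<noteq> c" "a \<noteq> c" using abc disj by auto
  then have tot: "(a, b) \<in> r \<or> (b, a) \<in> r" "(b, c) \<in> r \<or> (c, b) \<in> r" "(a, c) \<in> r \<or> (c, a) \<in> r"
    using lin om unfolding linear_order_on_def total_on_def by auto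
  \<comment> \<open>The three groups of facts exclude \<open>b\<close>, \<open>a\<close> and
    \<open>c\<close> in turn as the middle point; however the three pairs compare, some point lies
    between the other two.\<close>
  have 1: "\<not> ((a, b) \<in> r \<and> (b, c) \<in> r)" "\<not> ((c, b) \<in> r \<and> (b, a) \<in> r)"
    using mid[of a A b B c C] mid[of c C b B a A] abc om adj adj' disj by blast+
  have 2: "\<not> ((b, a) \<in> r \<and> (a, c) \<in> r)" "\<not> ((c, a) \<in> r \<and> (a, b) \<in> r)"
    using mid[of b B a A c C] mid[of c C a A b B] abc om adj adj' disj by blast+
  have 3: "\<not> ((a, c) \<in> r \<and> (c, b) \<in> r)" "\<not> ((b, c) \<in> r \<and> (c, a) \<in> r)"
    using mid[of a A c C b B] mid[of b B c C a A] abc om adj adj' disj by blast+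
  from tot 1 2 3 show False by blast
qed

section \<open>Autonomous sets and cohorts in a finite patchwork\<close>

locale finite_patchwork =
  fixes \<Omega> :: "'a set" and P :: "'a set set"
  assumes patchwork: "patchwork \<Omega> P" and finite_P: "finite P"
begin

lemma overlap_closed:
  assumes "A \<in> P" "B \<in> P" "overlap A B"
  shows "A \<inter> B \<in> P" "A \<union> B \<in> P" "A - B \<in> P"
  using patchwork assms unfolding patchwork_def by auto

lemma finite_cohort: "finite (cohort P B)"
  by (rule finite_subset[OF _ finite_P]) (auto simp: cohort_def autonomous_def)

lemma cohort_memberD:
  assumes "A \<in> cohort P B"
  shows "A \<in> P" "A \<noteq> {}" "A \<subset> B" "autonomous P A"
  using assms unfolding cohort_def autonomous_def by auto

text \<open>Maximality rules out inclusion and autonomy rules out overlap.\<close>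

lemma cohort_disjoint:
  assumes "A \<in> cohort P B" "A' \<in> cohort P B" "A \<noteq> A'"
  shows "A \<inter> A' = {}"
proof -
  have "\<not> A \<subset> A'" "\<not> A' \<subset> A" using assms unfolding cohort_def by blast+
  moreover have "\<not> overlap A A'" using assms unfolding cohort_def autonomous_def by blast
  ultimately show ?thesis using assms(3) unfolding overlap_def by blast
qed

lemma cohort_member_cases:
  assumes "A \<in> cohort P B" "X \<in> P"
  obtains "A \<inter> X = {}" | "A \<subseteq> X" | "X \<subseteq> A"
  using assms cohort_memberD(4) unfolding autonomous_def overlap_def by blast

lemma autonomous_subset_cohort_member:
  assumes "autonomous P X" "X \<subset> B"
  obtains A where "A \<in> cohort P B" "X \<subseteq> A"
proof -
  let ?F = "{A. autonomous P A \<and> A \<subset> B}"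
  have "finite ?F" by (rule finite_subset[OF _ finite_P]) (auto simp: autonomous_def)
  then obtain A where A: "A \<in> ?F" "X \<subseteq> A" "\<forall>C\<in>?F. A \<subseteq> C \<longrightarrow> A = C"
    using finite_has_maximal2[of ?F X] assms by blast
  then have "A \<in> cohort P B" unfolding cohort_def by blast
  with A show thesis using that by blast
qed

text \<open>By finiteness there is a minimal \<open>P\<close>-set \<open>Y\<close> through
  \<open>x\<close>. If some \<open>Z\<close> overlapped it, \<open>x\<close> would lie in
  \<open>Y \<inter> Z\<close> or in \<open>Y - Z\<close>, a smaller \<open>P\<close>-set.\<close>

lemma autonomous_subset_containing_point:
  assumes "X \<in> P" "x \<in> X"
  obtains Y where "autonomous P Y" "x \<in> Y" "Y \<subseteq> X"
proof -
  let ?F = "{Y \<in> P. x \<in> Y}"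
  obtain Y where Y: "Y \<in> ?F" "Y \<subseteq> X" "\<forall>C\<in>?F. C \<subseteq> Y \<longrightarrow> Y = C"
    using finite_has_minimal2[of ?F X] assms finite_P by auto
  have "\<not> overlap Y Z" if "Z \<in> P" for Z
  proof
    assume o: "overlap Y Z"
    have "Y \<inter> Z \<in> P" "Y - Z \<in> P" using overlap_closed o Y(1) that by auto
    then have "Y = Y \<inter> Z \<or> Y = Y - Z"
      using Y(1) bspec[OF Y(3), of "Y \<inter> Z"] bspec[OF Y(3), of "Y - Z"] by auto
    then show False using o unfolding overlap_def by blast
  qed
  then have "autonomous P Y" using Y unfolding autonomous_def by auto
  with Y show thesis using that by blast
qed

text \<open>Shows that \<open>X\<close> is a union of cohort members: an autonomous set through
  \<open>x\<close> inside \<open>X\<close> extends to a cohort member, which meets \<open>X\<close>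
  without containing it and therefore lies inside \<open>X\<close>.\<close>

lemma cohort_cover:
  assumes "X \<in> P" "X \<subset> B" "\<And>A. A \<in> cohort P B \<Longrightarrow> \<not> X \<subseteq> A" "x \<in> X"
  obtains A where "A \<in> cohort P B" "x \<in> A" "A \<subseteq> X"
proof -
  obtain Y where Y: "autonomous P Y" "x \<in> Y" "Y \<subseteq> X"
    using autonomous_subset_containing_point assms by blast
  then obtain A where A: "A \<in> cohort P B" "Y \<subseteq> A"
    using autonomous_subset_cohort_member[of Y B] assms(2) by blast
  have "A \<subseteq> X" by (rule cohort_member_cases[OF A(1) assms(1)]) (use Y A assms(3,4) in auto)
  with A Y show thesis using that by blast
qed

text \<open>A minimal counterexample \<open>X\<close> is not autonomous, so some \<open>Y\<close>
  overlaps it. The smaller sets \<open>X \<inter> Y\<close> and \<open>X - Y\<close> lie in cohort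
  members, whose union turns out to be \<open>X\<close>; these two members are then
  adjacent.\<close>

lemma subset_cohort_member_if_no_adjacent:
  assumes noadj: "\<And>A A'. A \<in> cohort P B \<Longrightarrow> A' \<in> cohort P B \<Longrightarrow> A \<noteq> A' \<Longrightarrow> \<not> adjacent P A A'"
    and "X \<in> P" "X \<subset> B" "X \<noteq> {}"
  shows "\<exists>A\<in>cohort P B. X \<subseteq> A"
proof (rule ccontr)
  assume neg: "\<not> ?thesis"
  define F where "F = {X \<in> P. X \<subset> B \<and> X \<noteq> {} \<and> \<not> (\<exists>A\<in>cohort P B. X \<subseteq> A)}"
  have "finite F" using finite_P unfolding F_def by auto
  moreover have "F \<noteq> {}" using neg assms unfolding F_def by blast
  ultimately obtain X where XF: "X \<in> F" and minX: "\<And>Y. Y \<in> F \<Longrightarrow> Y \<subseteq> X \<Longrightarrow> X = Y"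
    using finite_has_minimal[of F] by metis
  have X: "X \<in> P" "X \<subset> B" "X \<noteq> {}" "\<And>A. A \<in> cohort P B \<Longrightarrow> \<not> X \<subseteq> A"
    using XF unfolding F_def by auto
  have "\<not> autonomous P X" using autonomous_subset_cohort_member[of X B] X(2,4) by blast
  then obtain Y where Y: "Y \<in> P" "overlap X Y" using X unfolding autonomous_def by auto
  have inside: "\<exists>A\<in>cohort P B. W \<subseteq> A" if "W \<in> P" "W \<subset> X" "W \<noteq> {}" for W
    using minX[of W] that X(2) unfolding F_def by blast
  have "X \<inter> Y \<subset> X" "X \<inter> Y \<noteq> {}" "X - Y \<subset> X" "X - Y \<noteq> {}"
    using Y(2) unfolding overlap_def by blast+
  then obtain A A' where A: "A \<in> cohort P B" "X \<inter> Y \<subseteq> A" "A' \<in> cohort P B" "X - Y \<subseteq> A'"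
    using inside overlap_closed(1,3)[OF X(1) Y] by metis
  have "A \<subseteq> X"
    by (rule cohort_member_cases[OF A(1) X(1)]) (use Y(2) A X(4) in \<open>auto simp: overlap_def\<close>)
  moreover have "A' \<subseteq> X"
    by (rule cohort_member_cases[OF A(3) X(1)]) (use Y(2) A X(4) in \<open>auto simp: overlap_def\<close>)
  ultimately have XA: "X = A \<union> A'" using A by blast
  then have "A \<noteq> A'" using X(4)[OF A(1)] by blast
  moreover have "adjacent P A A'"
    using cohort_disjoint[OF A(1,3) \<open>A \<noteq> A'\<close>] cohort_memberD(1)[OF A(1)] cohort_memberD(1)[OF A(3)] X(1) XA
    unfolding adjacent_def by auto
  ultimately show False using noadj A by blast
qed

text \<open>A minimal \<open>P\<close>-set \<open>X\<close> overlapping \<open>\<Union>S\<close> is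
  cut down along an edge \<open>A\<close>, \<open>A'\<close> leaving the members of \<open>S\<close>
  inside \<open>X\<close>. This splits \<open>X\<close> into \<open>A\<close> and a rest
  \<open>Z\<close> outside \<open>\<Union>S\<close>. Either \<open>Z\<close> is a cohort member
  adjacent to \<open>A\<close>, against \<open>closed\<close>, or a set overlapping \<open>Z\<close>
  yields a smaller choice of \<open>X\<close>.\<close>

lemma connected_component_autonomous:
  assumes B: "autonomous P B" and S: "S \<subseteq> cohort P B" and U: "\<Union>S \<in> P" and ne: "S \<noteq> {}"
    and conn: "\<And>T. T \<subseteq> S \<Longrightarrow> T \<noteq> {} \<Longrightarrow> T \<noteq> S \<Longrightarrow> \<exists>A\<in>T. \<exists>A'\<in>S - T. adjacent P A A'"
    and closed: "\<And>A C. A \<in> S \<Longrightarrow> C \<in> cohort P B \<Longrightarrow> adjacent P A C \<Longrightarrow> C \<in> S"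
  shows "autonomous P (\<Union>S)"
proof (rule ccontr)
  assume neg: "\<not> autonomous P (\<Union>S)"
  have "\<Union>S \<noteq> {}" using ne S cohort_memberD(2) by blast
  with neg U have ex: "\<exists>X\<in>P. overlap (\<Union>S) X" unfolding autonomous_def by auto
  let ?F = "{X \<in> P. overlap (\<Union>S) X}"
  obtain X where X: "X \<in> ?F" and minX: "\<forall>Y\<in>?F. Y \<subseteq> X \<longrightarrow> X = Y"
    using finite_has_minimal[of ?F] ex finite_P by auto
  have XP: "X \<in> P" and meet: "\<Union>S \<inter> X \<noteq> {}" and nsub: "\<not> \<Union>S \<subseteq> X" "\<not> X \<subseteq> \<Union>S"
    using X unfolding overlap_def by auto
  have SB: "\<Union>S \<subseteq> B" using S cohort_memberD(3) by blast
  have XB: "X \<subset> B" using B XP meet nsub SB unfolding autonomous_def overlap_def by blast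
  define T where "T = {A \<in> S. A \<subseteq> X}"
  have in_T: "A \<in> T" if "A \<in> S" "A \<inter> X \<noteq> {}" for A
    using cohort_member_cases[of A B X] that S XP nsub unfolding T_def by blast
  have "T \<noteq> {}" using in_T meet by blast
  moreover have "T \<noteq> S" using nsub(1) unfolding T_def by blast
  moreover have "T \<subseteq> S" unfolding T_def by blast
  ultimately obtain A A' where A: "A \<in> T" "A' \<in> S - T" "adjacent P A A'" using conn by blast
  have AS: "A \<in> S" "A \<subseteq> X" "A \<in> cohort P B" "A \<noteq> {}"
    using A S cohort_memberD(2) unfolding T_def by blast+
  have A': "A' \<inter> X = {}" "A' \<noteq> {}" "A' \<subseteq> \<Union>S" using in_T A S cohort_memberD(2) by blast+
  \<comment> \<open>Since \<open>A'\<close> misses \<open>X\<close>, subtracting the whole edge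
    \<open>A \<union> A'\<close> from \<open>X\<close> removes exactly \<open>A\<close>.\<close>
  have "overlap X (A \<union> A')" using A' AS nsub unfolding overlap_def by blast
  then have "X - (A \<union> A') \<in> P" using overlap_closed(3) XP A(3) unfolding adjacent_def by blast
  moreover define Z where "Z = X - A"
  ultimately have ZP: "Z \<in> P" using A'(1) by (metis Diff_Un Diff_triv Int_absorb2 Diff_subset Int_commute)
  \<comment> \<open>\<open>Z\<close> is a proper subset of the minimal \<open>X\<close>. It has
    points outside \<open>\<Union>S\<close> and lacks the points of \<open>A\<close>, so not
    overlapping can only mean disjointness.\<close>
  have "\<not> overlap (\<Union>S) Z" using minX ZP AS unfolding Z_def by blast
  then have ZU: "Z \<inter> \<Union>S = {}" using nsub AS unfolding overlap_def Z_def by blast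
  have Zne: "Z \<noteq> {}" using nsub AS unfolding Z_def by blast
  have Znot: "\<not> Z \<subseteq> C" if C: "C \<in> cohort P B" for C
  proof
    assume ZC: "Z \<subseteq> C"
    have "A \<noteq> C" using ZC Zne unfolding Z_def by blast
    then have disj: "A \<inter> C = {}" using cohort_disjoint AS(3) C by blast
    have "C \<subseteq> X"
    proof (rule cohort_member_cases[OF C XP])
      assume "C \<inter> X = {}"
      then show ?thesis using ZC Zne unfolding Z_def by blast
    next
      assume "X \<subseteq> C"
      then show ?thesis using disj AS by blast
    qed
    then have "C = Z" using ZC disj unfolding Z_def by blast
    moreover have "X = A \<union> Z" using AS unfolding Z_def by blast
    ultimately have "adjacent P A C"
      using disj XP ZP cohort_memberD(1)[OF AS(3)] unfolding adjacent_def by auto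
    then have "C \<in> S" using closed AS(1) C by blast
    then show False using ZU Zne \<open>C = Z\<close> by blast
  qed
  have "\<not> autonomous P Z"
    using autonomous_subset_cohort_member[of Z B] Znot XB unfolding Z_def by blast
  then obtain Y where Y: "Y \<in> P" "overlap Z Y" using ZP Zne unfolding autonomous_def by blast
  \<comment> \<open>If \<open>Y\<close> misses \<open>A\<close>, then \<open>X - Y\<close> keeps all
    of \<open>A\<close>; otherwise \<open>X \<inter> Y\<close> keeps part of it. Either set still
    overlaps \<open>\<Union>S\<close> and is properly smaller than \<open>X\<close>.\<close>
  show False
  proof (cases "Y \<inter> A = {}")
    case True
    have "overlap X Y" using True Y(2) AS unfolding overlap_def Z_def by blast
    then have "X - Y \<in> P" using overlap_closed XP Y(1) by blast
    moreover have "overlap (\<Union>S) (X - Y)"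
      using True AS nsub ZU Y(2) unfolding overlap_def Z_def by blast
    ultimately have "X = X - Y" using minX by blast
    then show False using Y(2) unfolding overlap_def Z_def by blast
  next
    case False
    have "Y \<subseteq> X \<or> overlap X Y" using Y(2) unfolding overlap_def Z_def by blast
    then have "X \<inter> Y \<in> P" using overlap_closed(1)[OF XP Y(1)] Y(1) by (metis Int_absorb1)
    moreover have "overlap (\<Union>S) (X \<inter> Y)"
      using False AS nsub ZU Y(2) unfolding overlap_def Z_def by blast
    ultimately have "X = X \<inter> Y" using minX by blast
    then show False using Y(2) unfolding overlap_def Z_def by blast
  qed
qed

section \<open>Walks in the adjacency graph of a cohort\<close>

text \<open>Injectivity makes this a simple path, numbered from 1 as in
  \<open>is_path_graph\<close>. Chords are not excluded here; \<open>cohort_walk_induced\<close>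
  derives their absence.\<close>

definition cohort_walk :: "'a set \<Rightarrow> nat \<Rightarrow> (nat \<Rightarrow> 'a set) \<Rightarrow> bool" where
  "cohort_walk B n v \<longleftrightarrow> inj_on v {1..n} \<and> v ` {1..n} \<subseteq> cohort P B \<and>
     (\<forall>i. 1 \<le> i \<and> i < n \<longrightarrow> adjacent P (v i) (v (Suc i)))"

lemma cohort_walk_member:
  "cohort_walk B n v \<Longrightarrow> 1 \<le> i \<Longrightarrow> i \<le> n \<Longrightarrow> v i \<in> cohort P B"
  unfolding cohort_walk_def by auto

lemma cohort_walk_disjoint:
  assumes "cohort_walk B n v" "1 \<le> i" "i \<le> n" "1 \<le> j" "j \<le> n" "i \<noteq> j"
  shows "v i \<inter> v j = {}"
proof (rule cohort_disjoint)
  show "v i \<in> cohort P B" "v j \<in> cohort P B" using cohort_walk_member assms by blast+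
  show "v i \<noteq> v j" using assms unfolding cohort_walk_def by (auto dest: inj_onD)
qed

text \<open>Extend the right end by one vertex: for \<open>i < j\<close> the union so far overlaps
  the edge \<open>v j \<union> v (Suc j)\<close> in \<open>v j\<close>, so the larger union is again
  a \<open>P\<close>-set; for \<open>i = j\<close> it is the edge itself.\<close>

lemma cohort_walk_interval:
  assumes w: "cohort_walk B n v" and "1 \<le> i" "i \<le> j" "j \<le> n"
  shows "(\<Union>k\<in>{i..j}. v k) \<in> P"
  using assms(3,4)
proof (induction j rule: dec_induct)
  case base
  then show ?case using cohort_memberD(1)[OF cohort_walk_member[OF w assms(2)]] by simp
next
  case (step j)
  have adj: "adjacent P (v j) (v (Suc j))"
    using w step assms(2) unfolding cohort_walk_def by auto
  have eq: "(\<Union>k\<in>{i..Suc j}. v k) = (\<Union>k\<in>{i..j}. v k) \<union> (v j \<union> v (Suc j))"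
    using step(1) by (auto simp: atLeastAtMostSuc_conv)
  show ?case
  proof (cases "i = j")
    case True
    then show ?thesis using adj eq unfolding adjacent_def by auto
  next
    case False
    have d: "v i \<inter> (v j \<union> v (Suc j)) = {}" "v i \<noteq> {}"
      using cohort_walk_disjoint[OF w, of i j] cohort_walk_disjoint[OF w, of i "Suc j"]
        cohort_memberD(2)[OF cohort_walk_member[OF w, of i]] assms(2) step False by auto
    have "v k \<inter> v (Suc j) = {}" if "k \<in> {i..j}" for k
      using cohort_walk_disjoint[OF w, of k "Suc j"] that assms(2) step by auto
    then have d': "(\<Union>k\<in>{i..j}. v k) \<inter> v (Suc j) = {}" by blast
    have d'': "v (Suc j) \<noteq> {}" "v j \<noteq> {}"
      using cohort_memberD(2)[OF cohort_walk_member[OF w]] assms(2) step by auto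
    define U where "U = (\<Union>k\<in>{i..j}. v k)"
    have "v i \<subseteq> U" "v j \<subseteq> U" unfolding U_def using step by auto
    then have "overlap U (v j \<union> v (Suc j))"
      using d d'[folded U_def] d'' unfolding overlap_def by blast
    then show ?thesis
      using overlap_closed(2)[of U "v j \<union> v (Suc j)"] step adj eq unfolding adjacent_def U_def by auto
  qed
qed

text \<open>The given edge is a walk with two vertices, and injectivity bounds the number of
  vertices by the size of the cohort, so a greatest number exists.\<close>

lemma maximal_cohort_walk_exists:
  assumes "A \<in> cohort P B" "A' \<in> cohort P B" "A \<noteq> A'" "adjacent P A A'"
  obtains n v where "n \<ge> 2" "cohort_walk B n v" "\<And>w. \<not> cohort_walk B (Suc n) w"
proof -
  let ?Q = "\<lambda>n. \<exists>v. cohort_walk B n v"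
  have bound: "n \<le> card (cohort P B)" if "?Q n" for n
    using that card_inj_on_le[OF _ _ finite_cohort] unfolding cohort_walk_def by fastforce
  have "cohort_walk B 2 (\<lambda>i. if i = 1 then A else A')"
    using assms unfolding cohort_walk_def inj_on_def by (auto simp: le_Suc_eq numeral_2_eq_2)
  then have Q2: "?Q 2" by blast
  have "?Q (Greatest ?Q)" by (rule GreatestI_nat[of ?Q, OF Q2 bound])
  moreover have greatest: "m \<le> Greatest ?Q" if "?Q m" for m
    by (rule Greatest_le_nat[of ?Q, OF that bound])
  ultimately show thesis using that greatest[OF Q2] by (metis Suc_n_not_le_n)
qed

lemma cohort_walk_append:
  assumes "cohort_walk B n v" "C \<in> cohort P B" "C \<notin> v ` {1..n}" "adjacent P (v n) C"
  shows "cohort_walk B (Suc n) (v(Suc n := C))"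
proof -
  let ?w = "v(Suc n := C)"
  have ins: "{1..Suc n} = insert (Suc n) {1..n}" by auto
  have im: "?w ` {1..n} = v ` {1..n}" by (rule image_cong) auto
  have "inj_on v {1..n}" using assms(1) unfolding cohort_walk_def by blast
  moreover have "inj_on ?w {1..n} \<longleftrightarrow> inj_on v {1..n}" by (rule inj_on_cong) auto
  ultimately have "inj_on ?w {1..n}" by blast
  then have "inj_on ?w {1..Suc n}" unfolding ins using im assms(3) by auto
  moreover have "?w ` {1..Suc n} \<subseteq> cohort P B"
    unfolding ins image_insert im using assms unfolding cohort_walk_def by auto
  moreover have "adjacent P (?w i) (?w (Suc i))" if "1 \<le> i" "i < Suc n" for i
    using assms that unfolding cohort_walk_def by (cases "i = n") auto
  ultimately show ?thesis unfolding cohort_walk_def by blast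
qed

text \<open>Reduces extension at the first vertex to extension at the last.\<close>

lemma cohort_walk_rev:
  assumes "cohort_walk B n v"
  shows "cohort_walk B n (\<lambda>i. v (Suc n - i))"
proof -
  have "inj_on (\<lambda>i. v (Suc n - i)) {1..n}"
  proof (rule inj_onI)
    fix i j assume h: "i \<in> {1..n}" "j \<in> {1..n}" "v (Suc n - i) = v (Suc n - j)"
    then have "Suc n - i = Suc n - j"
      using assms unfolding cohort_walk_def by (intro inj_onD[of v "{1..n}"]) auto
    then show "i = j" using h by auto
  qed
  moreover have "(\<lambda>i. v (Suc n - i)) ` {1..n} \<subseteq> cohort P B"
    using cohort_walk_member[OF assms] by auto
  moreover have "adjacent P (v (Suc n - i)) (v (Suc n - Suc i))" if "1 \<le> i" "i < n" for i
  proof -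
    have "adjacent P (v (n - i)) (v (Suc (n - i)))" using assms that unfolding cohort_walk_def by auto
    then show ?thesis using that by (auto simp: adjacent_def Suc_diff_le Un_commute Int_commute)
  qed
  ultimately show ?thesis unfolding cohort_walk_def by blast
qed

text \<open>Supplies the hypothesis \<open>conn\<close> of
  \<open>connected_component_autonomous\<close>: without a crossing edge, membership in
  \<open>T\<close> would propagate along the walk.\<close>

lemma cohort_walk_crossing:
  assumes w: "cohort_walk B n v" and T: "T \<subseteq> v ` {1..n}" "T \<noteq> {}" "T \<noteq> v ` {1..n}"
  shows "\<exists>A\<in>T. \<exists>A'\<in>v ` {1..n} - T. adjacent P A A'"
proof (rule ccontr)
  assume neg: "\<not> ?thesis"
  have step: "v k \<in> T \<longleftrightarrow> v (Suc k) \<in> T" if "1 \<le> k" "k < n" for k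
  proof -
    have "adjacent P (v k) (v (Suc k))" using w that unfolding cohort_walk_def by auto
    moreover from this have "adjacent P (v (Suc k)) (v k)"
      by (auto simp: adjacent_def Un_commute Int_commute)
    ultimately show ?thesis using neg that by (metis Diff_iff Suc_leI atLeastAtMost_iff image_eqI le_SucI less_imp_le_nat)
  qed
  have all: "v k \<in> T \<longleftrightarrow> v 1 \<in> T" if "1 \<le> k" "k \<le> n" for k
    using that by (induction k rule: dec_induct) (use step in auto)
  obtain l where "1 \<le> l" "l \<le> n" "v l \<in> T" using T(1,2) by fastforce
  then have "v 1 \<in> T" using all by blast
  then have "v ` {1..n} \<subseteq> T" using all by auto
  then show False using T(1,3) by blast
qed

section \<open>Cohorts in the absence of three pairwise adjacent sets\<close>

context
  assumes no_triangle: "\<And>A B C. A \<noteq> {} \<Longrightarrow> B \<noteq> {} \<Longrightarrow> C \<noteq> {} \<Longrightarrow>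
    adjacent P A B \<Longrightarrow> adjacent P B C \<Longrightarrow> adjacent P A C \<Longrightarrow> False"
begin

text \<open>A chord closes a triangle formed by \<open>v i\<close>, \<open>v j\<close> and the union
  of the vertices strictly between them, which is nonempty because \<open>Suc i < j\<close>.\<close>

lemma cohort_walk_induced:
  assumes w: "cohort_walk B n v" and ij: "1 \<le> i" "Suc i < j" "j \<le> n"
  shows "\<not> adjacent P (v i) (v j)"
proof
  assume adj: "adjacent P (v i) (v j)"
  let ?M = "\<Union>k\<in>{Suc i..j - 1}. v k"
  have M: "?M \<in> P" "(\<Union>k\<in>{i..j - 1}. v k) \<in> P" "(\<Union>k\<in>{Suc i..j}. v k) \<in> P"
    using cohort_walk_interval[OF w] ij by auto
  have "{i..j - 1} = insert i {Suc i..j - 1}" "{Suc i..j} = insert j {Suc i..j - 1}" using ij by auto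
  then have eq: "(\<Union>k\<in>{i..j - 1}. v k) = v i \<union> ?M" "(\<Union>k\<in>{Suc i..j}. v k) = ?M \<union> v j" by auto
  have "v i \<inter> v k = {}" "v k \<inter> v j = {}" if "k \<in> {Suc i..j - 1}" for k
    using cohort_walk_disjoint[OF w, of i k] cohort_walk_disjoint[OF w, of k j] ij that by fastforce+
  then have "v i \<inter> ?M = {}" "?M \<inter> v j = {}" by blast+
  then have "adjacent P (v i) ?M" "adjacent P ?M (v j)"
    using M eq adj unfolding adjacent_def by auto
  moreover have ne: "v k \<noteq> {}" if "1 \<le> k" "k \<le> n" for k
    using cohort_memberD(2)[OF cohort_walk_member[OF w that]] .
  moreover have "?M \<noteq> {}" using ne[of "Suc i"] ij by auto
  ultimately show False using no_triangle[of "v i" ?M "v j"] adj ij by auto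
qed

text \<open>A new neighbour \<open>C\<close> of an end vertex would lengthen the walk. At an inner
  vertex, removing \<open>v k \<union> C\<close> from the union of \<open>v k\<close> and its two
  walk neighbours makes these neighbours adjacent, which closes a triangle.\<close>

lemma cohort_walk_maximal_closed:
  assumes w: "cohort_walk B n v" and maxw: "\<And>w. \<not> cohort_walk B (Suc n) w"
    and k: "1 \<le> k" "k \<le> n" and C: "C \<in> cohort P B" "adjacent P (v k) C"
  shows "C \<in> v ` {1..n}"
proof (rule ccontr)
  assume notin: "C \<notin> v ` {1..n}"
  consider "k = n" | "k = 1" | "1 < k" "k < n" using k by linarith
  then show False
  proof cases
    case 1
    then show False using cohort_walk_append[OF w C(1) notin] C(2) maxw by blast
  next
    case 2
    have "(\<lambda>i. v (Suc n - i)) ` {1..n} \<subseteq> v ` {1..n}" by (intro image_subsetI imageI) auto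
    then have "cohort_walk B (Suc n) ((\<lambda>i. v (Suc n - i))(Suc n := C))"
      using cohort_walk_append[OF cohort_walk_rev[OF w] C(1)] notin C(2) 2 by auto
    then show False using maxw by blast
  next
    case 3
    define j where "j = k - 1"
    have j: "1 \<le> j" "k = Suc j" "Suc (Suc j) \<le> n" using 3 unfolding j_def by auto
    have "{j..Suc (Suc j)} = {j, k, Suc k}" using j by auto
    then have tri: "v j \<union> v k \<union> v (Suc k) \<in> P"
      using cohort_walk_interval[OF w, of j "Suc (Suc j)"] j by (simp add: Un_assoc)
    have adj: "adjacent P (v j) (v k)" "adjacent P (v k) (v (Suc k))"
      using w j unfolding cohort_walk_def by auto
    have disj: "v j \<inter> v k = {}" "v j \<inter> v (Suc k) = {}" "v k \<inter> v (Suc k) = {}"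
      using cohort_walk_disjoint[OF w] j by auto
    have ne: "v j \<noteq> {}" "v k \<noteq> {}" "v (Suc k) \<noteq> {}" "C \<noteq> {}"
      using cohort_memberD(2)[OF cohort_walk_member[OF w]] cohort_memberD(2)[OF C(1)] j by auto
    have Cd: "C \<inter> v i = {}" if "1 \<le> i" "i \<le> n" for i
      by (rule cohort_disjoint[OF C(1) cohort_walk_member[OF w that]]) (use notin that in auto)
    have Cd': "C \<inter> v j = {}" "C \<inter> v k = {}" "C \<inter> v (Suc k) = {}" using Cd j by auto
    obtain x y z where "x \<in> v k" "y \<in> v j" "z \<in> C" using ne by blast
    then have "x \<in> (v j \<union> v k \<union> v (Suc k)) \<inter> (v k \<union> C)"
      "y \<in> (v j \<union> v k \<union> v (Suc k)) - (v k \<union> C)" "z \<in> (v k \<union> C) - (v j \<union> v k \<union> v (Suc k))"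
      using disj Cd' by auto
    then have "overlap (v j \<union> v k \<union> v (Suc k)) (v k \<union> C)" unfolding overlap_def by blast
    then have "(v j \<union> v k \<union> v (Suc k)) - (v k \<union> C) \<in> P"
      using overlap_closed(3) tri C(2) unfolding adjacent_def by blast
    moreover have "(v j \<union> v k \<union> v (Suc k)) - (v k \<union> C) = v j \<union> v (Suc k)"
      using disj Cd' by blast
    ultimately have "adjacent P (v j) (v (Suc k))" using adj disj unfolding adjacent_def by auto
    then show False using no_triangle[OF ne(1-3) adj] by blast
  qed
qed

text \<open>The vertices of a maximal walk have an autonomous union. It properly contains the cohort
  member \<open>v 1\<close>, so maximality of \<open>v 1\<close> leaves only \<open>B\<close>;
  disjointness then puts every cohort member on the walk.\<close>

lemma cohort_path:
  assumes B: "autonomous P B"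
    and A: "A \<in> cohort P B" "A' \<in> cohort P B" "A \<noteq> A'" "adjacent P A A'"
  shows "card (cohort P B) \<ge> 2 \<and> is_path_graph (adjacency_graph P (cohort P B)) \<and> \<Union> (cohort P B) = B"
proof -
  obtain n v where n: "n \<ge> 2" and w: "cohort_walk B n v" and maxw: "\<And>w. \<not> cohort_walk B (Suc n) w"
    using maximal_cohort_walk_exists[OF A] by blast
  let ?S = "v ` {1..n}"
  have S: "?S \<subseteq> cohort P B" and inj: "inj_on v {1..n}" using w unfolding cohort_walk_def by auto
  have "autonomous P (\<Union>?S)"
  proof (rule connected_component_autonomous[OF B S])
    show "\<Union>?S \<in> P" using cohort_walk_interval[OF w, of 1 n] n by simp
    show "?S \<noteq> {}" using n by auto
    show "\<exists>A\<in>T. \<exists>A'\<in>?S - T. adjacent P A A'" if "T \<subseteq> ?S" "T \<noteq> {}" "T \<noteq> ?S" for T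
      using cohort_walk_crossing[OF w that] .
    show "C \<in> ?S" if "A \<in> ?S" "C \<in> cohort P B" "adjacent P A C" for A C
      using cohort_walk_maximal_closed[OF w maxw _ _ that(2)] that(1,3) by auto
  qed
  moreover have "v 1 \<subset> \<Union>?S"
  proof -
    have "v 1 \<subseteq> \<Union>?S" "v 2 \<subseteq> \<Union>?S" using n by (intro UN_upper, simp)+
    moreover have "v 1 \<inter> v 2 = {}" "v 2 \<noteq> {}"
      using cohort_walk_disjoint[OF w, of 1 2] cohort_memberD(2)[OF cohort_walk_member[OF w, of 2]] n by auto
    ultimately show ?thesis by (metis Int_absorb1 psubsetI)
  qed
  moreover have "v 1 \<in> cohort P B" using S n by auto
  moreover have "\<Union>?S \<subseteq> B" using S cohort_memberD(3) by blast
  ultimately have UB: "\<Union>?S = B" unfolding cohort_def by blast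
  have eq: "cohort P B = ?S"
  proof
    show "cohort P B \<subseteq> ?S"
    proof
      fix C assume C: "C \<in> cohort P B"
      obtain x where "x \<in> C" using cohort_memberD(2)[OF C] by blast
      moreover from this have "x \<in> \<Union>?S" using cohort_memberD(3)[OF C] unfolding UB by blast
      ultimately obtain D where "D \<in> ?S" "x \<in> D" by blast
      then have "D = C" using cohort_disjoint[OF C] S \<open>x \<in> C\<close> by blast
      then show "C \<in> ?S" using \<open>D \<in> ?S\<close> by blast
    qed
  qed (rule S)
  have adj_iff: "{v i, v j} \<in> snd (adjacency_graph P (cohort P B)) \<longleftrightarrow> \<bar>int i - int j\<bar> = 1"
    if ij: "i \<in> {1..n}" "j \<in> {1..n}" for i j
  proof -
    \<comment> \<open>Edges are unordered pairs, so both orientations of adjacency have to be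
      identified.\<close>
    have sym: "adjacent P X Y \<longleftrightarrow> adjacent P Y X" for X Y
      by (auto simp: adjacent_def Un_commute Int_commute)
    have "{v i, v j} \<in> snd (adjacency_graph P (cohort P B)) \<longleftrightarrow> v i \<noteq> v j \<and> adjacent P (v i) (v j)"
      (is "?e \<longleftrightarrow> ?d")
    proof
      show ?d if ?e using that sym unfolding adjacency_graph_def by (auto simp: doubleton_eq_iff)
      have "v i \<in> cohort P B" "v j \<in> cohort P B" using S ij by auto
      then show ?e if ?d using that unfolding adjacency_graph_def snd_conv mem_Collect_eq by blast
    qed
    also have "\<dots> \<longleftrightarrow> i \<noteq> j \<and> adjacent P (v i) (v j)" using inj_on_eq_iff[OF inj ij] by simp
    also have "\<dots> \<longleftrightarrow> i = Suc j \<or> j = Suc i"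
    proof
      assume h: "i \<noteq> j \<and> adjacent P (v i) (v j)"
      then show "i = Suc j \<or> j = Suc i"
        using cohort_walk_induced[OF w, of i j] cohort_walk_induced[OF w, of j i] sym ij
        by (auto simp: not_less dest: le_antisym) (metis Suc_lessI nat_neq_iff)
    next
      assume "i = Suc j \<or> j = Suc i"
      then show "i \<noteq> j \<and> adjacent P (v i) (v j)"
        using w ij sym unfolding cohort_walk_def by auto
    qed
    also have "\<dots> \<longleftrightarrow> \<bar>int i - int j\<bar> = 1" by auto
    finally show ?thesis .
  qed
  have "bij_betw v {1..n} (cohort P B)" using inj eq unfolding bij_betw_def by simp
  then have "is_path_graph (adjacency_graph P (cohort P B))"
    using adj_iff n unfolding is_path_graph_def
    by (intro exI[of _ n] exI[of _ v]) (auto simp: adjacency_graph_def)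
  moreover have "card (cohort P B) \<ge> 2" using eq card_image[OF inj] n by simp
  ultimately show ?thesis using UB eq by simp
qed

end

section \<open>Convex orders built from cohorts\<close>

text \<open>Around a missing \<open>v k\<close>, take the nearest members \<open>v a\<close> and
  \<open>v b\<close> inside \<open>X\<close> on either side. The walk interval from \<open>a\<close>
  to \<open>b\<close> meets \<open>X\<close> exactly in \<open>v a \<union> v b\<close>, which makes
  these two adjacent although \<open>k\<close> lies strictly between.\<close>

lemma cohort_path_union_convex:
  assumes w: "cohort_walk B n v"
    and nadj: "\<And>i j. 1 \<le> i \<Longrightarrow> Suc i < j \<Longrightarrow> j \<le> n \<Longrightarrow> \<not> adjacent P (v i) (v j)"
    and X: "X \<in> P" "X \<subset> B" "\<And>A. A \<in> cohort P B \<Longrightarrow> \<not> X \<subseteq> A"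
    and ikj: "1 \<le> i" "i < k" "k < j" "j \<le> n" and ij: "v i \<subseteq> X" "v j \<subseteq> X"
  shows "v k \<subseteq> X"
proof (rule ccontr)
  assume nk: "\<not> v k \<subseteq> X"
  let ?Q = "\<lambda>l. v l \<subseteq> X"
  have alt: "v l \<inter> X = {}" if "\<not> ?Q l" "1 \<le> l" "l \<le> n" for l
    using cohort_member_cases[OF cohort_walk_member[OF w that(2,3)] X(1)]
      X(3)[OF cohort_walk_member[OF w that(2,3)]] that by blast
  define a where "a = Max {l. l < k \<and> 1 \<le> l \<and> ?Q l}"
  define b where "b = (LEAST l. k < l \<and> l \<le> n \<and> ?Q l)"
  have finm: "finite {l. l < k \<and> 1 \<le> l \<and> ?Q l}" by auto
  have "a \<in> {l. l < k \<and> 1 \<le> l \<and> ?Q l}"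
    unfolding a_def by (rule Max_in) (use ikj ij in auto)
  then have a: "a < k" "1 \<le> a" "?Q a" by auto
  have amax: "\<not> ?Q l" if "a < l" "l < k" for l
    using Max_ge[OF finm, of l] that a unfolding a_def[symmetric] by auto
  have "k < b \<and> b \<le> n \<and> ?Q b"
    unfolding b_def by (rule LeastI[of _ j]) (use ikj ij in auto)
  then have b: "k < b" "b \<le> n" "?Q b" by auto
  have bmin: "\<not> ?Q l" if "k < l" "l < b" for l
    using not_less_Least[of l "\<lambda>l. k < l \<and> l \<le> n \<and> ?Q l"] that b unfolding b_def[symmetric] by auto
  let ?I = "\<Union>l\<in>{a..b}. v l"
  have I: "?I \<in> P" using cohort_walk_interval[OF w, of a b] a b by simp
  have gap: "v l \<inter> X = {}" if "a < l" "l < b" for l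
    using alt[of l] amax[of l] bmin[of l] nk that a b by (cases l k rule: linorder_cases) auto
  have IX: "?I \<inter> X = v a \<union> v b"
  proof
    have "v a \<subseteq> ?I" "v b \<subseteq> ?I" using a b by (intro UN_upper, simp)+
    then show "v a \<union> v b \<subseteq> ?I \<inter> X" using a b by blast
    show "?I \<inter> X \<subseteq> v a \<union> v b"
    proof
      fix x assume "x \<in> ?I \<inter> X"
      then obtain l where l: "a \<le> l" "l \<le> b" "x \<in> v l" "x \<in> X" by auto
      then have "l = a \<or> l = b" using gap[of l] by (cases "l = a"; cases "l = b") auto
      then show "x \<in> v a \<union> v b" using l by auto
    qed
  qed
  have "v k \<subseteq> ?I" "v k \<inter> X = {}" "v k \<noteq> {}" "v a \<noteq> {}"
    using a b gap[of k] cohort_memberD(2)[OF cohort_walk_member[OF w]] by auto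
  then have "\<not> ?I \<subseteq> X" "?I \<inter> X \<noteq> {}" using IX by (metis Int_absorb2 order_trans, simp)
  \<comment> \<open>The part \<open>v k\<close> of \<open>?I\<close> lies outside \<open>X\<close>.
    So either \<open>X\<close> itself is the intersection, or closure under overlap applies.\<close>
  then have "X \<subseteq> ?I \<or> overlap ?I X" unfolding overlap_def by simp
  then have "?I \<inter> X \<in> P" using overlap_closed(1)[OF I X(1)] X(1) by (metis Int_absorb1)
  then have "adjacent P (v a) (v b)"
    using IX cohort_memberD(1)[OF cohort_walk_member[OF w]] cohort_walk_disjoint[OF w, of a b] a b
    unfolding adjacent_def by auto
  then show False using nadj[of a b] a b by auto
qed

text \<open>The construction shared by both alternatives of (c): blocks are ordered by number and
  each carries the order given by \<open>ord\<close>. The assumption \<open>blocks\<close> makes the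
  indices of the members inside \<open>X\<close> an interval.\<close>

lemma convex_order_on_cohort_blocks:
  fixes v :: "nat \<Rightarrow> 'a set"
  assumes bij: "bij_betw v {1..n} (cohort P B)"
    and ord: "\<And>A. A \<in> cohort P B \<Longrightarrow>
      \<exists>r. linear_order_on A r \<and> (\<forall>X\<in>P. X \<subseteq> A \<longrightarrow> convex_wrt r A X)"
    and blocks: "\<And>X i j k. X \<in> P \<Longrightarrow> X \<subset> B \<Longrightarrow> (\<And>A. A \<in> cohort P B \<Longrightarrow> \<not> X \<subseteq> A) \<Longrightarrow>
      1 \<le> i \<Longrightarrow> i < k \<Longrightarrow> k < j \<Longrightarrow> j \<le> n \<Longrightarrow> v i \<subseteq> X \<Longrightarrow> v j \<subseteq> X \<Longrightarrow> v k \<subseteq> X"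
  shows "\<exists>r. linear_order_on B r \<and> (\<forall>X\<in>P. X \<subseteq> B \<longrightarrow> convex_wrt r B X)"
proof -
  obtain R where R: "\<And>A. A \<in> cohort P B \<Longrightarrow>
      linear_order_on A (R A) \<and> (\<forall>X\<in>P. X \<subseteq> A \<longrightarrow> convex_wrt (R A) A X)"
    using ord by metis
  have inj: "inj_on v {1..n}" and im: "v ` {1..n} = cohort P B" using bij unfolding bij_betw_def by auto
  have mem: "v i \<in> cohort P B" if "1 \<le> i" "i \<le> n" for i using im that by auto
  have uniq: "i = j" if "x \<in> v i" "x \<in> v j" "1 \<le> i" "i \<le> n" "1 \<le> j" "j \<le> n" for x i j
    using cohort_disjoint[OF mem[OF that(3,4)] mem[OF that(5,6)]] inj that
    by (metis atLeastAtMost_iff disjoint_iff inj_onD)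
  \<comment> \<open>Block 0 collects the points of \<open>B\<close> outside every cohort member.\<close>
  define f where "f x = (if \<exists>i\<in>{1..n}. x \<in> v i then THE i. i \<in> {1..n} \<and> x \<in> v i else 0)" for x
  have f_in: "f x = i" if "x \<in> v i" "1 \<le> i" "i \<le> n" for x i
  proof -
    have "(THE i. i \<in> {1..n} \<and> x \<in> v i) = i"
      by (rule the_equality) (use that uniq in auto)
    then show ?thesis using that unfolding f_def by auto
  qed
  have f_out: "f x = 0" if "\<And>i. 1 \<le> i \<Longrightarrow> i \<le> n \<Longrightarrow> x \<notin> v i" for x
    using that unfolding f_def by auto
  have f_le: "f x \<le> n" for x
    using f_in f_out by (metis le0)
  have f_pos: "x \<in> v (f x)" if "f x \<ge> 1" for x
    using f_in f_out that by (metis not_one_le_zero)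
  have fib: "{x \<in> B. f x = i} = v i" if "1 \<le> i" "i \<le> n" for i
    using f_in f_pos cohort_memberD(3)[OF mem[OF that]] that by auto
  have fib0: "{x \<in> B. f x = i} = {}" if "n < i" for i
    using f_le that by (auto simp: not_le[symmetric])
  \<comment> \<open>Any order serves for block 0: a \<open>P\<close>-set properly inside
    \<open>B\<close> lies in a cohort member or is a union of such members, so it misses block
    0.\<close>
  obtain r0 where r0: "linear_order_on {x \<in> B. f x = 0} r0" using linear_order_on_exists by blast
  \<comment> \<open>Blocks beyond \<open>n\<close> are empty, and \<open>{}\<close> is the linear
    order on the empty set.\<close>
  define Q where "Q i = (if i = 0 then r0 else if i \<le> n then R (v i) else {})" for i
  have Q: "linear_order_on {x \<in> B. f x = i} (Q i)" for i
  proof (cases "1 \<le> i \<and> i \<le> n")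
    case True
    then show ?thesis using fib[of i] R[OF mem[of i]] unfolding Q_def by simp
  next
    case False
    then consider "i = 0" | "n < i" "i \<noteq> 0" by linarith
    then show ?thesis
    proof cases
      case 1
      then show ?thesis using r0 unfolding Q_def by simp
    next
      case 2
      then show ?thesis unfolding fib0[OF 2(1)] Q_def using lnear_order_on_empty by simp
    qed
  qed
  let ?r = "{(x, y). x \<in> B \<and> y \<in> B \<and> (f x < f y \<or> f x = f y \<and> (x, y) \<in> Q (f x))}"
  have "linear_order_on B ?r" by (rule linear_order_on_concatenation[OF Q])
  moreover have "convex_wrt ?r B X" if X: "X \<in> P" "X \<subseteq> B" for X
  proof (cases "\<exists>A\<in>cohort P B. X \<subseteq> A")
    case True
    then have "\<exists>i\<in>{1..n}. X \<subseteq> v i" unfolding im[symmetric] by blast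
    then obtain i where i: "1 \<le> i" "i \<le> n" "X \<subseteq> v i" by auto
    have cv: "convex_wrt (R (v i)) (v i) X" using R[OF mem[OF i(1,2)]] X i by blast
    show ?thesis unfolding convex_wrt_def
    proof (intro ballI impI)
      fix p s q assume h: "p \<in> X" "s \<in> X" "q \<in> B" "(p, q) \<in> ?r \<and> (q, s) \<in> ?r"
      have fps: "f p = i" "f s = i" using f_in i h(1,2) by auto
      moreover have "f p \<le> f q" "f q \<le> f s" using h(4) by auto
      ultimately have fq: "f q = i" by simp
      then have "(p, q) \<in> Q i" "(q, s) \<in> Q i" using h(4) fps by simp_all
      moreover have "q \<in> v i" using f_pos[of q] fq i by simp
      moreover have "Q i = R (v i)" using i unfolding Q_def by simp
      ultimately show "q \<in> X" using cv h(1,2) unfolding convex_wrt_def by metis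
    qed
  next
    case False
    show ?thesis
    proof (cases "X = B")
      case True
      then show ?thesis unfolding convex_wrt_def by auto
    next
      case neq: False
      then have XB: "X \<subset> B" using X by blast
      have cover: "1 \<le> f x \<and> f x \<le> n \<and> x \<in> v (f x) \<and> v (f x) \<subseteq> X" if x: "x \<in> X" for x
      proof -
        obtain A where A: "A \<in> cohort P B" "x \<in> A" "A \<subseteq> X"
          using cohort_cover[OF X(1) XB _ x] False by blast
        from A(1) obtain i where "1 \<le> i" "i \<le> n" "A = v i" unfolding im[symmetric] by auto
        then show ?thesis using A f_in by auto
      qed
      show ?thesis unfolding convex_wrt_def
      proof (intro ballI impI)
        fix p s q assume h: "p \<in> X" "s \<in> X" "q \<in> B" "(p, q) \<in> ?r \<and> (q, s) \<in> ?r"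
        have le: "f p \<le> f q" "f q \<le> f s" using h(4) by auto
        \<comment> \<open>The block of \<open>q\<close> is that of \<open>p\<close> or of
          \<open>s\<close>, both inside \<open>X\<close> by \<open>cover\<close>, or it lies
          strictly between them, where \<open>blocks\<close> applies.\<close>
        have "v (f q) \<subseteq> X"
        proof (cases "f p = f q \<or> f q = f s")
          case True
          then show ?thesis using cover h by metis
        next
          case ne: False
          then show ?thesis using blocks[OF X(1) XB, of "f p" "f q" "f s"] cover h le False by auto
        qed
        moreover have "q \<in> v (f q)" using f_pos le cover[OF h(1)] by auto
        ultimately show "q \<in> X" by blast
      qed
    qed
  qed
  ultimately show ?thesis by blast
qed

text \<open>Translates the graph condition into the form used by
  \<open>cohort_path_union_convex\<close>: a walk through the whole cohort without chords.\<close>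

lemma path_graph_cohort_walk:
  assumes "is_path_graph (adjacency_graph P (cohort P B))"
  obtains n v where "bij_betw v {1..n} (cohort P B)" "cohort_walk B n v"
    "\<And>i j. 1 \<le> i \<Longrightarrow> Suc i < j \<Longrightarrow> j \<le> n \<Longrightarrow> \<not> adjacent P (v i) (v j)"
proof -
  obtain n v where bij: "bij_betw v {1..n} (cohort P B)"
    and edge: "\<And>i j. i \<in> {1..n} \<Longrightarrow> j \<in> {1..n} \<Longrightarrow>
      {v i, v j} \<in> snd (adjacency_graph P (cohort P B)) \<longleftrightarrow> \<bar>int i - int j\<bar> = 1"
    using assms unfolding is_path_graph_def by (auto simp: adjacency_graph_def)
  have inj: "inj_on v {1..n}" and im: "v ` {1..n} = cohort P B" using bij unfolding bij_betw_def by auto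
  have "adjacent P (v i) (v (Suc i))" if "1 \<le> i" "i < n" for i
  proof -
    have "{v i, v (Suc i)} \<in> snd (adjacency_graph P (cohort P B))" using edge[of i "Suc i"] that by auto
    then show ?thesis
      unfolding adjacency_graph_def by (auto simp: doubleton_eq_iff adjacent_def Un_commute Int_commute)
  qed
  then have "cohort_walk B n v" using inj im unfolding cohort_walk_def by auto
  moreover have "\<not> adjacent P (v i) (v j)" if "1 \<le> i" "Suc i < j" "j \<le> n" for i j
  proof
    assume adj: "adjacent P (v i) (v j)"
    have m: "i \<in> {1..n}" "j \<in> {1..n}" using that by auto
    then have "v i \<noteq> v j" using inj_onD[OF inj _ m] that(2) by auto
    then have "{v i, v j} \<in> snd (adjacency_graph P (cohort P B))"
      using adj m im unfolding adjacency_graph_def snd_conv mem_Collect_eq by blast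
    then show False using edge[OF m] that by auto
  qed
  ultimately show thesis using that bij by blast
qed

text \<open>Induction on the number of \<open>P\<close>-sets properly inside \<open>B\<close>. This
  number drops for a cohort member \<open>A\<close>, since \<open>A\<close> is counted for
  \<open>B\<close> but not for itself.\<close>

lemma convex_order_on_autonomous:
  assumes c: "\<And>B. autonomous P B \<Longrightarrow>
      (card (cohort P B) \<ge> 2 \<and> is_path_graph (adjacency_graph P (cohort P B)) \<and> \<Union> (cohort P B) = B) \<or>
      (\<forall>A\<in>cohort P B. \<forall>A'\<in>cohort P B. A \<noteq> A' \<longrightarrow> \<not> adjacent P A A')"
    and "autonomous P B"
  shows "\<exists>r. linear_order_on B r \<and> (\<forall>X\<in>P. X \<subseteq> B \<longrightarrow> convex_wrt r B X)"
  using assms(2)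
proof (induction "card {A \<in> P. A \<subset> B}" arbitrary: B rule: less_induct)
  case less
  have ord: "\<exists>r. linear_order_on A r \<and> (\<forall>X\<in>P. X \<subseteq> A \<longrightarrow> convex_wrt r A X)" if A: "A \<in> cohort P B" for A
  proof (rule less.hyps)
    show "autonomous P A" using cohort_memberD(4)[OF A] .
    have "{C \<in> P. C \<subset> A} \<subset> {C \<in> P. C \<subset> B}" using cohort_memberD(1,3)[OF A] by blast
    then show "card {C \<in> P. C \<subset> A} < card {C \<in> P. C \<subset> B}"
      using finite_P by (intro psubset_card_mono) auto
  qed
  from c[OF less.prems] show ?case
  proof (elim disjE conjE)
    assume "is_path_graph (adjacency_graph P (cohort P B))"
    then obtain n v where v: "bij_betw v {1..n} (cohort P B)" "cohort_walk B n v"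
      "\<And>i j. 1 \<le> i \<Longrightarrow> Suc i < j \<Longrightarrow> j \<le> n \<Longrightarrow> \<not> adjacent P (v i) (v j)"
      by (rule path_graph_cohort_walk) (rule that)
    show ?thesis
      by (rule convex_order_on_cohort_blocks[OF v(1) ord])
        (assumption, rule cohort_path_union_convex[OF v(2,3)])
  next
    assume na: "\<forall>A\<in>cohort P B. \<forall>A'\<in>cohort P B. A \<noteq> A' \<longrightarrow> \<not> adjacent P A A'"
    \<comment> \<open>Any enumeration works: no nonempty \<open>P\<close>-set properly inside
      \<open>B\<close> escapes all cohort members, so the block condition holds vacuously.\<close>
    obtain v where v: "bij_betw v {1..card (cohort P B)} (cohort P B)"
      using ex_bij_betw_nat_finite_1[OF finite_cohort] by blast
    show ?thesis
    proof (rule convex_order_on_cohort_blocks[OF v ord])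
      fix X i j k
      assume h: "X \<in> P" "X \<subset> B" "\<And>A. A \<in> cohort P B \<Longrightarrow> \<not> X \<subseteq> A"
        and ikj: "1 \<le> i" "i < k" "k < j" "j \<le> card (cohort P B)" and "v i \<subseteq> X"
      have "v i \<in> cohort P B" using v ikj unfolding bij_betw_def by auto
      then have "X \<noteq> {}" using \<open>v i \<subseteq> X\<close> cohort_memberD(2) by blast
      then show "v k \<subseteq> X" using subset_cohort_member_if_no_adjacent[of B X] na h by blast
    qed
  qed
qed

end

section \<open>Equivalence of order, adjacency and cohort conditions\<close>

theorem theorem4p10:
  fixes \<Omega> :: "'a set" and P :: "'a set set"
  assumes "patchwork \<Omega> P" and "finite P"
  shows "((\<exists>r. linear_order_on \<Omega> r \<and> (\<forall>A\<in>P. convex_wrt r \<Omega> A)) \<longleftrightarrow>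
          \<not> (\<exists>A\<in>P. \<exists>B\<in>P. \<exists>C\<in>P. A \<noteq> {} \<and> B \<noteq> {} \<and> C \<noteq> {} \<and>
               adjacent P A B \<and> adjacent P B C \<and> adjacent P A C)) \<and>
         (\<not> (\<exists>A\<in>P. \<exists>B\<in>P. \<exists>C\<in>P. A \<noteq> {} \<and> B \<noteq> {} \<and> C \<noteq> {} \<and>
               adjacent P A B \<and> adjacent P B C \<and> adjacent P A C) \<longleftrightarrow>
          (\<forall>B. autonomous P B \<longrightarrow>
             (card (cohort P B) \<ge> 2 \<and> is_path_graph (adjacency_graph P (cohort P B)) \<and>
                \<Union> (cohort P B) = B) \<or>
             (\<forall>A\<in>cohort P B. \<forall>A'\<in>cohort P B. A \<noteq> A' \<longrightarrow> \<not> adjacent P A A')))"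
    (is "(?a \<longleftrightarrow> ?b) \<and> (?b \<longleftrightarrow> ?c)")
proof -
  interpret finite_patchwork \<Omega> P by unfold_locales (fact assms)+
  have sub: "P \<subseteq> Pow \<Omega>" and \<Omega>: "\<Omega> \<in> P" using assms(1) unfolding patchwork_def by auto
  have ab: ?b if a: ?a
  proof -
    from a obtain r where r: "linear_order_on \<Omega> r" "\<And>A. A \<in> P \<Longrightarrow> convex_wrt r \<Omega> A" by blast
    show ?thesis using convex_triple_not_pairwise_adjacent[OF r sub] by metis
  qed
  have bc: ?c if b: ?b
  proof -
    \<comment> \<open>Adjacency includes membership in \<open>P\<close>, so the bounded quantifiers
      give the unrestricted form of the assumption \<open>no_triangle\<close>.\<close>
    have "False" if "A \<noteq> {}" "B \<noteq> {}" "C \<noteq> {}" "adjacent P A B" "adjacent P B C" "adjacent P A C" for A B C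
      using b that unfolding adjacent_def by blast
    then show ?thesis using cohort_path by meson
  qed
  have ca: ?a if c: ?c
  proof (cases "\<Omega> = {}")
    case True
    \<comment> \<open>Autonomous sets are nonempty, so the empty \<open>\<Omega>\<close> is not
      covered by the induction.\<close>
    have "linear_order_on {} {}" by (simp add: lnear_order_on_empty)
    then show ?thesis using True sub by (intro exI[of _ "{}"]) (auto simp: convex_wrt_def)
  next
    case False
    have aut: "autonomous P \<Omega>" using False \<Omega> sub unfolding autonomous_def overlap_def by auto
    have "\<exists>r. linear_order_on \<Omega> r \<and> (\<forall>X\<in>P. X \<subseteq> \<Omega> \<longrightarrow> convex_wrt r \<Omega> X)"
      by (rule convex_order_on_autonomous[OF _ aut]) (erule c[THEN spec, THEN mp])
    moreover have "X \<subseteq> \<Omega>" if "X \<in> P" for X using sub that by blast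
    ultimately show ?thesis by metis
  qed
  show ?thesis
    \<comment> \<open>Both equivalences follow from the cycle \<open>ab\<close>, \<open>bc\<close>,
      \<open>ca\<close>.\<close>
    by (intro conjI iffI) (erule ab, erule ca[OF bc], erule bc, erule ab[OF ca])
qed

end
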